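(* If $\mathcal Q$ is a Kollár quasivariety and $\mathbf F_{\mathcal Q}$ is the only finitely generated relative simple algebra in $\mathcal Q$, then $\mathcal Q$ is passive structurally complete.
   Context: An algebra is Kollár if it is nontrivial and has no trivial subalgebras; a quasivariety is Kollár if all its nontrivial members are Kollár. A congruence $\theta$ of $\mathbf A\in\mathcal Q$ is relative if $\mathbf A/\theta\in\mathcal Q$; $\mathbf A$ is relative simple if it is nontrivial and its only relative congruences are the identity and the total congruence. $\mathbf F_{\mathcal Q}$ is $\mathbf F_{\mathcal Q}(\emptyset)$ if the type has constants, the one-generated free algebra otherwise; $\mathbf F_{\mathcal Q}(\omega)$ is the free algebra on countably many generators. A substitution (homomorphism from terms to $\mathbf F_{\mathcal Q}(\omega)$) unifies a set of equations $\Sigma$ if it identifies both sides of each; a quasiequation $\Sigma\Rightarrow\delta$ is admissible if every substitution unifying $\Sigma$ unifies $\delta$, passive if no substitution unifies $\Sigma$. $\mathcal Q$ is passive structurally complete if every passive admissible quasiequation is valid in $\mathcal Q$. *)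

theory Defs
  imports Main
begin

text \<open>
  A type of algebras is a partial map from operation symbols to finite arities; it may be empty,
  and no bound is put on the number of symbols. Operations take argument lists, and only their
  values on lists of the right length over the universe matter. Universes are nonempty.
\<close>

type_synonym 'f signature = "'f \<rightharpoonup> nat"

record ('f, 'a) algebra =
  univ :: "'a set"
  oper :: "'f \<Rightarrow> 'a list \<Rightarrow> 'a"

definition is_algebra :: "'f signature \<Rightarrow> ('f, 'a) algebra \<Rightarrow> bool" where
  "is_algebra S A \<longleftrightarrow> univ A \<noteq> {} \<and>
     (\<forall>f as. S f = Some (length as) \<longrightarrow> set as \<subseteq> univ A \<longrightarrow> oper A f as \<in> univ A)"

definition trivial_algebra :: "('f, 'a) algebra \<Rightarrow> bool" where
  "trivial_algebra A \<longleftrightarrow> (\<exists>a. univ A = {a})"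

definition subalgebra :: "'f signature \<Rightarrow> ('f, 'a) algebra \<Rightarrow> ('f, 'a) algebra \<Rightarrow> bool" where
  "subalgebra S B A \<longleftrightarrow> is_algebra S B \<and> univ B \<subseteq> univ A \<and>
     (\<forall>f as. S f = Some (length as) \<longrightarrow> set as \<subseteq> univ B \<longrightarrow> oper B f as = oper A f as)"

inductive_set generated :: "'f signature \<Rightarrow> ('f, 'a) algebra \<Rightarrow> 'a set \<Rightarrow> 'a set"
  for S :: "'f signature" and A :: "('f, 'a) algebra" and G :: "'a set" where
  gen_base: "a \<in> G \<Longrightarrow> a \<in> generated S A G"
| gen_oper: "S f = Some (length as) \<Longrightarrow> \<forall>a \<in> set as. a \<in> generated S A G
    \<Longrightarrow> oper A f as \<in> generated S A G"

definition finitely_generated :: "'f signature \<Rightarrow> ('f, 'a) algebra \<Rightarrow> bool" where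
  "finitely_generated S A \<longleftrightarrow>
     (\<exists>G. finite G \<and> G \<subseteq> univ A \<and> generated S A G = univ A)"

definition hom :: "'f signature \<Rightarrow> ('f, 'a) algebra \<Rightarrow> ('f, 'b) algebra \<Rightarrow> ('a \<Rightarrow> 'b) set" where
  "hom S A B = {h. (\<forall>a \<in> univ A. h a \<in> univ B) \<and>
     (\<forall>f as. S f = Some (length as) \<longrightarrow> set as \<subseteq> univ A
        \<longrightarrow> h (oper A f as) = oper B f (map h as))}"

definition isomorphic :: "'f signature \<Rightarrow> ('f, 'a) algebra \<Rightarrow> ('f, 'b) algebra \<Rightarrow> bool" where
  "isomorphic S A B \<longleftrightarrow> (\<exists>h \<in> hom S A B. bij_betw h (univ A) (univ B))"

definition congruence :: "'f signature \<Rightarrow> ('f, 'a) algebra \<Rightarrow> ('a \<times> 'a) set \<Rightarrow> bool" where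
  "congruence S A \<theta> \<longleftrightarrow> equiv (univ A) \<theta> \<and>
     (\<forall>f as bs. S f = Some (length as) \<longrightarrow> list_all2 (\<lambda>a b. (a, b) \<in> \<theta>) as bs
        \<longrightarrow> (oper A f as, oper A f bs) \<in> \<theta>)"

definition quotient_algebra :: "('f, 'a) algebra \<Rightarrow> ('a \<times> 'a) set \<Rightarrow> ('f, 'a set) algebra" where
  "quotient_algebra A \<theta> =
     \<lparr>univ = univ A // \<theta>, oper = \<lambda>f Cs. \<theta> `` {oper A f (map (\<lambda>C. SOME a. a \<in> C) Cs)}\<rparr>"


datatype ('f, 'v) trm = Var 'v | App 'f "('f, 'v) trm list"

inductive_set trms :: "'f signature \<Rightarrow> 'v set \<Rightarrow> ('f, 'v) trm set"
  for S :: "'f signature" and X :: "'v set" where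
  trms_Var: "x \<in> X \<Longrightarrow> Var x \<in> trms S X"
| trms_App: "S f = Some (length ts) \<Longrightarrow> \<forall>t \<in> set ts. t \<in> trms S X
    \<Longrightarrow> App f ts \<in> trms S X"

definition term_algebra :: "'f signature \<Rightarrow> 'v set \<Rightarrow> ('f, ('f, 'v) trm) algebra" where
  "term_algebra S X = \<lparr>univ = trms S X, oper = App\<rparr>"

primrec eval :: "('f, 'a) algebra \<Rightarrow> ('v \<Rightarrow> 'a) \<Rightarrow> ('f, 'v) trm \<Rightarrow> 'a" where
  "eval A v (Var x) = v x"
| "eval A v (App f ts) = oper A f (map (eval A v) ts)"

type_synonym 'f equation = "('f, nat) trm \<times> ('f, nat) trm"
type_synonym 'f quasiequation = "'f equation set \<times> 'f equation"

definition is_quasiequation :: "'f signature \<Rightarrow> 'f quasiequation \<Rightarrow> bool" where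
  "is_quasiequation S q \<longleftrightarrow> finite (fst q) \<and>
     insert (snd q) (fst q) \<subseteq> trms S UNIV \<times> trms S UNIV"

definition satisfies :: "('f, 'a) algebra \<Rightarrow> 'f quasiequation \<Rightarrow> bool" where
  "satisfies A q \<longleftrightarrow> (\<forall>v. range v \<subseteq> univ A \<longrightarrow>
     (\<forall>(s, t) \<in> fst q. eval A v s = eval A v t) \<longrightarrow>
     eval A v (fst (snd q)) = eval A v (snd (snd q)))"

text \<open>
  A quasivariety is the class of all models of a set \<open>Q\<close> of quasiequations, and \<open>Q\<close> stands for
  it below. As the class has members over every carrier type, notions quantifying over its members
  take as parameter the type the carriers are drawn from.
\<close>

definition in_quasivariety :: "'f signature \<Rightarrow> 'f quasiequation set \<Rightarrow> ('f, 'a) algebra \<Rightarrow> bool" where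
  "in_quasivariety S Q A \<longleftrightarrow> is_algebra S A \<and> (\<forall>q \<in> Q. satisfies A q)"

definition valid_in_quasivariety ::
    "'a itself \<Rightarrow> 'f signature \<Rightarrow> 'f quasiequation set \<Rightarrow> 'f quasiequation \<Rightarrow> bool" where
  "valid_in_quasivariety TYPE('a) S Q q \<longleftrightarrow>
     (\<forall>A :: ('f, 'a) algebra. in_quasivariety S Q A \<longrightarrow> satisfies A q)"

definition kollar_algebra :: "'f signature \<Rightarrow> ('f, 'a) algebra \<Rightarrow> bool" where
  "kollar_algebra S A \<longleftrightarrow> \<not> trivial_algebra A \<and> \<not> (\<exists>B. subalgebra S B A \<and> trivial_algebra B)"

definition kollar_quasivariety :: "'a itself \<Rightarrow> 'f signature \<Rightarrow> 'f quasiequation set \<Rightarrow> bool" where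
  "kollar_quasivariety TYPE('a) S Q \<longleftrightarrow>
     (\<forall>A :: ('f, 'a) algebra. in_quasivariety S Q A \<longrightarrow> \<not> trivial_algebra A \<longrightarrow> kollar_algebra S A)"

definition relative_congruence ::
    "'f signature \<Rightarrow> 'f quasiequation set \<Rightarrow> ('f, 'a) algebra \<Rightarrow> ('a \<times> 'a) set \<Rightarrow> bool" where
  "relative_congruence S Q A \<theta> \<longleftrightarrow>
     congruence S A \<theta> \<and> in_quasivariety S Q (quotient_algebra A \<theta>)"

definition relative_simple ::
    "'f signature \<Rightarrow> 'f quasiequation set \<Rightarrow> ('f, 'a) algebra \<Rightarrow> bool" where
  "relative_simple S Q A \<longleftrightarrow> \<not> trivial_algebra A \<and>
     {\<theta>. relative_congruence S Q A \<theta>} = {Id_on (univ A), univ A \<times> univ A}"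

definition fg_relative_simple ::
    "'f signature \<Rightarrow> 'f quasiequation set \<Rightarrow> ('f, 'a) algebra \<Rightarrow> bool" where
  "fg_relative_simple S Q A \<longleftrightarrow>
     in_quasivariety S Q A \<and> finitely_generated S A \<and> relative_simple S Q A"

text \<open>
  The free algebra over \<open>X\<close> is the quotient of the term algebra over \<open>X\<close> by its least relative
  congruence. It is only meaningful if there is some term over \<open>X\<close>.
\<close>

definition free_algebra ::
    "'f signature \<Rightarrow> 'f quasiequation set \<Rightarrow> 'v set \<Rightarrow> ('f, ('f, 'v) trm set) algebra" where
  "free_algebra S Q X = quotient_algebra (term_algebra S X)
     (\<Inter> {\<theta>. relative_congruence S Q (term_algebra S X) \<theta>})"

abbreviation free_omega ::
    "'f signature \<Rightarrow> 'f quasiequation set \<Rightarrow> ('f, ('f, nat) trm set) algebra" where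
  "free_omega S Q \<equiv> free_algebra S Q UNIV"

definition least_free_algebra ::
    "'f signature \<Rightarrow> 'f quasiequation set \<Rightarrow> ('f, ('f, nat) trm set) algebra" where
  "least_free_algebra S Q =
     (if \<exists>c. S c = Some 0 then free_algebra S Q {} else free_algebra S Q {0})"

definition substitutions ::
    "'f signature \<Rightarrow> 'f quasiequation set \<Rightarrow> (('f, nat) trm \<Rightarrow> ('f, nat) trm set) set" where
  "substitutions S Q = hom S (term_algebra S UNIV) (free_omega S Q)"

definition unifies :: "(('f, nat) trm \<Rightarrow> 'b) \<Rightarrow> 'f equation set \<Rightarrow> bool" where
  "unifies h E \<longleftrightarrow> (\<forall>(s, t) \<in> E. h s = h t)"

definition admissible_quasiequation ::
    "'f signature \<Rightarrow> 'f quasiequation set \<Rightarrow> 'f quasiequation \<Rightarrow> bool" where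
  "admissible_quasiequation S Q q \<longleftrightarrow>
     (\<forall>h \<in> substitutions S Q. unifies h (fst q) \<longrightarrow> unifies h {snd q})"

definition passive_quasiequation ::
    "'f signature \<Rightarrow> 'f quasiequation set \<Rightarrow> 'f quasiequation \<Rightarrow> bool" where
  "passive_quasiequation S Q q \<longleftrightarrow> \<not> (\<exists>h \<in> substitutions S Q. unifies h (fst q))"

definition passive_structurally_complete ::
    "'a itself \<Rightarrow> 'f signature \<Rightarrow> 'f quasiequation set \<Rightarrow> bool" where
  "passive_structurally_complete TYPE('a) S Q \<longleftrightarrow>
     (\<forall>q. is_quasiequation S q \<longrightarrow> passive_quasiequation S Q q \<longrightarrow> admissible_quasiequation S Q q
        \<longrightarrow> valid_in_quasivariety TYPE('a) S Q q)"

text \<open>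
  Every finitely generated algebra, and every free algebra on countably many generators, is a
  quotient of the term algebra over \<open>\<omega>\<close>. A carrier type that is at least as large as that term
  algebra thus has isomorphic copies of all of them.
\<close>

definition large_carrier_type :: "'a itself \<Rightarrow> 'f signature \<Rightarrow> bool" where
  "large_carrier_type TYPE('a) S \<longleftrightarrow>
     (\<exists>e :: ('f, nat) trm \<Rightarrow> 'a. inj_on e (trms S UNIV))"

end

theory Submission
  imports Defs
begin

text \<open>
  Suppose a passive quasiequation fails in a member \<open>B\<close> of \<open>Q\<close> under a valuation \<open>v\<close>, and let \<open>X\<close>
  be a finite set containing its variables. By the Kollar property, the equations
  \<open>x = f(x, \<dots>, x)\<close> for all operation symbols \<open>f\<close> imply \<open>y = z\<close> in \<open>Q\<close>; as relative congruence
  generation is finitary, finitely many of them do. Hence the total congruence of the term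
  algebra over \<open>X\<close> is not the union of a chain of proper relative congruences, and Zorn's lemma
  extends the kernel of the evaluation at \<open>v\<close> to a maximal proper relative congruence. The quotient
  by it is finitely generated and relative simple, so it is the least free algebra, which maps to
  the free algebra on countably many generators. The composite unifies the premises of the
  quasiequation, contradicting passivity.
\<close>

section \<open>Homomorphisms, terms and quotients\<close>

definition ker_rel :: "('f, 'a) algebra \<Rightarrow> ('a \<Rightarrow> 'b) \<Rightarrow> ('a \<times> 'a) set" where
  "ker_rel A h = {(a, b). a \<in> univ A \<and> b \<in> univ A \<and> h a = h b}"

text \<open>This says on \<open>A\<close> itself that the quotient by \<open>\<theta>\<close>
  satisfies \<open>q\<close>. As a closure condition on \<open>\<theta>\<close> it can be checked
  for intersections and directed unions, where the quotients are hard to compare.\<close>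

definition closed_under ::
    "('f, 'a) algebra \<Rightarrow> ('a \<times> 'a) set \<Rightarrow> 'f quasiequation \<Rightarrow> bool" where
  "closed_under A \<theta> q \<longleftrightarrow> (\<forall>v. range v \<subseteq> univ A \<longrightarrow>
     (\<forall>(s, t) \<in> fst q. (eval A v s, eval A v t) \<in> \<theta>) \<longrightarrow>
     (eval A v (fst (snd q)), eval A v (snd (snd q))) \<in> \<theta>)"

lemma ker_rel_iff: "(a, b) \<in> ker_rel A h \<longleftrightarrow> a \<in> univ A \<and> b \<in> univ A \<and> h a = h b"
  by (simp add: ker_rel_def)

lemma oper_in_univ:
  "is_algebra S A \<Longrightarrow> S f = Some (length as) \<Longrightarrow> set as \<subseteq> univ A \<Longrightarrow> oper A f as \<in> univ A"
  by (auto simp: is_algebra_def)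

lemma hom_in_univ: "h \<in> hom S A B \<Longrightarrow> a \<in> univ A \<Longrightarrow> h a \<in> univ B"
  by (auto simp: hom_def)

lemma hom_oper:
  "h \<in> hom S A B \<Longrightarrow> S f = Some (length as) \<Longrightarrow> set as \<subseteq> univ A
    \<Longrightarrow> h (oper A f as) = oper B f (map h as)"
  by (auto simp: hom_def)

lemma hom_comp:
  assumes "h \<in> hom S A B" "k \<in> hom S B C"
  shows "k \<circ> h \<in> hom S A C"
proof -
  have "set (map h as) \<subseteq> univ B" if "set as \<subseteq> univ A" for as
    using that assms(1) by (auto simp: hom_def)
  then show ?thesis
    using assms by (fastforce simp: hom_def)
qed

lemma eval_in_univ:
  assumes "t \<in> trms S X" "is_algebra S A" "v ` X \<subseteq> univ A"
  shows "eval A v t \<in> univ A"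
  using assms(1)
proof induction
  case (trms_Var x)
  then show ?case using assms(3) by auto
next
  case (trms_App f ts)
  then show ?case using oper_in_univ[OF assms(2), of f "map (eval A v) ts"] by auto
qed

lemma hom_eval:
  assumes "t \<in> trms S X" "is_algebra S A" "v ` X \<subseteq> univ A" "h \<in> hom S A B"
    and "\<And>x. x \<in> X \<Longrightarrow> h (v x) = w x"
  shows "h (eval A v t) = eval B w t"
  using assms(1)
proof induction
  case (trms_Var x)
  then show ?case using assms(5) by auto
next
  case (trms_App f ts)
  have "set (map (eval A v) ts) \<subseteq> univ A"
    using trms_App eval_in_univ[OF _ assms(2,3)] by auto
  then have "h (oper A f (map (eval A v) ts)) = oper B f (map h (map (eval A v) ts))"
    using trms_App hom_oper[OF assms(4)] by simp
  moreover have "map h (map (eval A v) ts) = map (eval B w) ts"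
    using trms_App by auto
  ultimately show ?case by (simp only: eval.simps)
qed

lemma univ_term_algebra [simp]: "univ (term_algebra S X) = trms S X"
  and oper_term_algebra [simp]: "oper (term_algebra S X) = App"
  by (simp_all add: term_algebra_def)

lemma is_algebra_term_algebra: "trms S X \<noteq> {} \<Longrightarrow> is_algebra S (term_algebra S X)"
  by (auto simp: is_algebra_def intro!: trms_App)

lemma eval_hom:
  assumes "is_algebra S A" "v ` X \<subseteq> univ A"
  shows "eval A v \<in> hom S (term_algebra S X) A"
  using eval_in_univ[OF _ assms] by (auto simp: hom_def)

text \<open>Together with \<open>hom_eval\<close> this gives that a homomorphism on terms is
  evaluation at its values on variables.\<close>

lemma eval_term_algebra_Var: "eval (term_algebra S X) Var t = t"
  by (induction t) (auto simp: map_idI)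

lemma trms_mono: "t \<in> trms S X \<Longrightarrow> X \<subseteq> Y \<Longrightarrow> t \<in> trms S Y"
  by (induction rule: trms.induct) (auto intro: trms.intros)

lemma trms_superset_vars: "t \<in> trms S Y \<Longrightarrow> set2_trm t \<subseteq> X \<Longrightarrow> t \<in> trms S X"
  by (induction rule: trms.induct) (fastforce intro: trms.intros)+

lemma finite_vars: "finite (set2_trm t)"
  by (induction t) auto

section \<open>Kernels, quotient algebras and factorization of homomorphisms\<close>

lemma congruence_ker_rel:
  assumes "is_algebra S A" "h \<in> hom S A B"
  shows "congruence S A (ker_rel A h)"
proof -
  have "equiv (univ A) (ker_rel A h)"
    by (auto simp: equiv_def refl_on_def sym_def trans_def ker_rel_def)
  moreover have "(oper A f as, oper A f bs) \<in> ker_rel A h"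
    if f: "S f = Some (length as)" and l: "list_all2 (\<lambda>a b. (a, b) \<in> ker_rel A h) as bs" for f as bs
  proof -
    have "length bs = length as" "set as \<subseteq> univ A" "set bs \<subseteq> univ A" "map h as = map h bs"
      using l by (auto simp: list_all2_conv_all_nth ker_rel_def in_set_conv_nth intro!: nth_equalityI)
    then show ?thesis
      using f assms hom_oper[OF assms(2)] oper_in_univ[OF assms(1)] by (simp add: ker_rel_iff)
  qed
  ultimately show ?thesis by (simp add: congruence_def)
qed

lemma congruence_subset: "congruence S A \<theta> \<Longrightarrow> \<theta> \<subseteq> univ A \<times> univ A"
  by (auto simp: congruence_def equiv_def refl_on_def)

lemma congruence_refl: "congruence S A \<theta> \<Longrightarrow> a \<in> univ A \<Longrightarrow> (a, a) \<in> \<theta>"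
  by (auto simp: congruence_def equiv_def refl_on_def)

text \<open>
  The values of \<open>r\<close> are codes for the classes of \<open>\<theta>\<close>; coding them in a type other than that of
  sets of elements gives copies of the quotient over other carrier types.
\<close>

lemma coded_quotient_hom:
  assumes A: "is_algebra S A" and \<theta>: "congruence S A \<theta>"
    and r: "\<And>a b. a \<in> univ A \<Longrightarrow> b \<in> univ A \<Longrightarrow> r a = r b \<longleftrightarrow> (a, b) \<in> \<theta>"
    and s: "\<And>a. a \<in> univ A \<Longrightarrow> s (r a) \<in> univ A \<and> r (s (r a)) = r a"
    and B: "univ B = r ` univ A"
    and operB: "\<And>f bs. oper B f bs = r (oper A f (map s bs))"
  shows "r \<in> hom S A B" "ker_rel A r = \<theta>" "is_algebra S B"
proof -
  show "r \<in> hom S A B"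
    unfolding hom_def
  proof (clarsimp simp: B operB)
    fix f as assume f: "S f = Some (length as)" and as: "set as \<subseteq> univ A"
    \<comment> \<open>\<open>s\<close> returns a representative that need not be the original
      argument, but is congruent to it; compatibility of \<open>\<theta>\<close> with
      \<open>f\<close> absorbs the difference.\<close>
    have "(s (r a), a) \<in> \<theta>" if "a \<in> univ A" for a
      using r s that by blast
    then have "list_all2 (\<lambda>a b. (a, b) \<in> \<theta>) (map (s \<circ> r) as) as"
      using as nth_mem by (fastforce simp: list_all2_conv_all_nth)
    then have "(oper A f (map (s \<circ> r) as), oper A f as) \<in> \<theta>"
      using \<theta> f by (auto simp: congruence_def)
    moreover have "oper A f (map (s \<circ> r) as) \<in> univ A" "oper A f as \<in> univ A"
      using calculation congruence_subset[OF \<theta>] by auto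
    ultimately show "r (oper A f as) = r (oper A f (map (s \<circ> r) as))"
      using r by metis
  qed
  show "ker_rel A r = \<theta>"
    using r congruence_subset[OF \<theta>] by (auto simp: ker_rel_def)
  show "is_algebra S B"
    unfolding is_algebra_def
  proof (intro conjI allI impI)
    show "univ B \<noteq> {}" using A B by (auto simp: is_algebra_def)
    fix f bs assume "S f = Some (length bs)" "set bs \<subseteq> univ B"
    then have "oper A f (map s bs) \<in> univ A"
      using s B by (intro oper_in_univ[OF A]) auto
    then show "oper B f bs \<in> univ B" by (simp add: operB B)
  qed
qed

text \<open>Here each class is its own code, and \<open>s\<close> is the choice of representatives
  built into \<open>quotient_algebra\<close>.\<close>

lemma
  assumes A: "is_algebra S A" and \<theta>: "congruence S A \<theta>"
  shows quotient_hom: "(\<lambda>a. \<theta> `` {a}) \<in> hom S A (quotient_algebra A \<theta>)"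
    and ker_rel_quotient: "ker_rel A (\<lambda>a. \<theta> `` {a}) = \<theta>"
    and is_algebra_quotient: "is_algebra S (quotient_algebra A \<theta>)"
    and quotient_surj: "(\<lambda>a. \<theta> `` {a}) ` univ A = univ (quotient_algebra A \<theta>)"
proof -
  have eq: "equiv (univ A) \<theta>" using \<theta> by (simp add: congruence_def)
  have r: "\<theta> `` {a} = \<theta> `` {b} \<longleftrightarrow> (a, b) \<in> \<theta>" if "a \<in> univ A" "b \<in> univ A" for a b
    using eq_equiv_class_iff[OF eq that] .
  have s: "(SOME b. b \<in> \<theta> `` {a}) \<in> univ A \<and> \<theta> `` {SOME b. b \<in> \<theta> `` {a}} = \<theta> `` {a}"
    if a: "a \<in> univ A" for a
  proof -
    have "(SOME b. b \<in> \<theta> `` {a}) \<in> \<theta> `` {a}"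
      using congruence_refl[OF \<theta> a] by (intro someI[of "\<lambda>b. b \<in> \<theta> `` {a}" a]) auto
    then show ?thesis
      using congruence_subset[OF \<theta>] r a by auto
  qed
  show surj: "(\<lambda>a. \<theta> `` {a}) ` univ A = univ (quotient_algebra A \<theta>)"
    by (auto simp: quotient_algebra_def quotient_def)
  note * = coded_quotient_hom[where r = "\<lambda>a. \<theta> `` {a}" and s = "\<lambda>C. SOME a. a \<in> C"
      and B = "quotient_algebra A \<theta>", OF A \<theta> r s surj[symmetric]]
  show "(\<lambda>a. \<theta> `` {a}) \<in> hom S A (quotient_algebra A \<theta>)"
    by (rule *) (auto simp: quotient_algebra_def)
  show "ker_rel A (\<lambda>a. \<theta> `` {a}) = \<theta>"
    by (rule *) (auto simp: quotient_algebra_def)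
  show "is_algebra S (quotient_algebra A \<theta>)"
    by (rule *) (auto simp: quotient_algebra_def)
qed

text \<open>The Kollar property and the assumption on simple algebras concern algebras over one
  fixed carrier type, so quotients of term algebras have to be rebuilt there. A class is coded by
  the image under \<open>e\<close> of a chosen representative, so an injection of elements
  suffices.\<close>

lemma quotient_in_carrier_type:
  fixes A :: "('f, 'b) algebra" and e :: "'b \<Rightarrow> 'a"
  assumes A: "is_algebra S A" and \<theta>: "congruence S A \<theta>" and e: "inj_on e (univ A)"
  obtains B :: "('f, 'a) algebra" and h where "h \<in> hom S A B" "h ` univ A = univ B"
    "ker_rel A h = \<theta>" "is_algebra S B"
proof -
  have eq: "equiv (univ A) \<theta>" using \<theta> by (simp add: congruence_def)
  \<comment> \<open>The choice depends on the class alone, so congruent elements get the same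
    representative.\<close>
  define c where "c a = (SOME b. b \<in> \<theta> `` {a})" for a
  have c: "(a, c a) \<in> \<theta>" if "a \<in> univ A" for a
    using congruence_refl[OF \<theta> that] someI[of "\<lambda>b. b \<in> \<theta> `` {a}" a] by (auto simp: c_def)
  have cA: "c a \<in> univ A" if "a \<in> univ A" for a
    using c[OF that] congruence_subset[OF \<theta>] by auto
  have c_eq: "c a = c b \<longleftrightarrow> (a, b) \<in> \<theta>" if "a \<in> univ A" "b \<in> univ A" for a b
  proof
    assume "c a = c b"
    then have "(a, c b) \<in> \<theta>" "(b, c b) \<in> \<theta>" using c that by metis+
    then show "(a, b) \<in> \<theta>" using eq by (meson equivE symD transD)
  next
    assume "(a, b) \<in> \<theta>"
    then show "c a = c b" using equiv_class_eq[OF eq] by (simp add: c_def)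
  qed
  define r where "r = e \<circ> c"
  define s where "s = inv_into (univ A) e"
  have sr: "s (r a) = c a" if "a \<in> univ A" for a
    using e cA[OF that] by (simp add: r_def s_def)
  define B where "B = \<lparr>univ = r ` univ A, oper = \<lambda>f bs. r (oper A f (map s bs))\<rparr>"
  have r: "r a = r b \<longleftrightarrow> (a, b) \<in> \<theta>" if "a \<in> univ A" "b \<in> univ A" for a b
    using e cA that c_eq[OF that] by (auto simp: r_def inj_on_def)
  have s: "s (r a) \<in> univ A \<and> r (s (r a)) = r a" if a: "a \<in> univ A" for a
    using cA[OF a] c[OF a] r[OF a cA[OF a]] unfolding sr[OF a] by metis
  note * = coded_quotient_hom[where r = r and s = s and B = B, OF A \<theta> r s]
  show thesis
    by (rule that[of r B]; (rule *)?) (auto simp: B_def)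
qed

lemma hom_factor:
  assumes B: "is_algebra S B" and h: "h \<in> hom S A B" "h ` univ A = univ B" and h': "h' \<in> hom S A C"
    and ker: "ker_rel A h \<subseteq> ker_rel A h'" and A: "is_algebra S A"
  obtains k where "k \<in> hom S B C" "\<And>a. a \<in> univ A \<Longrightarrow> k (h a) = h' a"
proof -
  \<comment> \<open>\<open>s\<close> picks preimages under \<open>h\<close>; the inclusion of
    kernels makes \<open>h' \<circ> s\<close> independent of the choice.\<close>
  define s where "s = inv_into (univ A) h"
  have s: "s b \<in> univ A" "h (s b) = b" if "b \<in> univ B" for b
    using that h(2) by (auto simp: s_def inv_into_into f_inv_into_f)
  have k: "h' (s (h a)) = h' a" if "a \<in> univ A" for a
  proof -
    have "(s (h a), a) \<in> ker_rel A h"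
      using s[of "h a"] hom_in_univ[OF h(1)] that by (simp add: ker_rel_iff)
    then have "(s (h a), a) \<in> ker_rel A h'" using ker by blast
    then show ?thesis by (simp add: ker_rel_iff)
  qed
  have "h' \<circ> s \<in> hom S B C"
    unfolding hom_def
  proof (intro CollectI conjI ballI allI impI)
    show "(h' \<circ> s) b \<in> univ C" if "b \<in> univ B" for b
      using s that hom_in_univ[OF h'] by auto
    fix f bs assume f: "S f = Some (length bs)" and bs: "set bs \<subseteq> univ B"
    have sb: "set (map s bs) \<subseteq> univ A" using s bs by auto
    have "map h (map s bs) = bs" using s(2) bs by (auto intro!: map_idI)
    then have "h (oper A f (map s bs)) = oper B f bs"
      using hom_oper[OF h(1) _ sb] f by simp
    then have "h' (s (oper B f bs)) = h' (oper A f (map s bs))"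
      using k[OF oper_in_univ[OF A _ sb]] f by (metis length_map)
    then show "(h' \<circ> s) (oper B f bs) = oper C f (map (h' \<circ> s) bs)"
      using hom_oper[OF h' _ sb] f by simp
  qed
  then show thesis using k by (intro that) auto
qed

section \<open>Relative congruences\<close>

locale quasivariety =
  fixes S :: "'f signature" and Q :: "'f quasiequation set"
  assumes wf: "\<forall>q \<in> Q. is_quasiequation S q"
begin

lemma quasiequation_terms:
  assumes "q \<in> Q"
  shows "(s, t) \<in> fst q \<Longrightarrow> s \<in> trms S UNIV \<and> t \<in> trms S UNIV"
    "fst (snd q) \<in> trms S UNIV" "snd (snd q) \<in> trms S UNIV" "finite (fst q)"
  using wf[rule_format, OF assms]
  by (auto simp: is_quasiequation_def mem_Times_iff)

lemma closed_under_ker_rel: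
  assumes A: "is_algebra S A" and h: "h \<in> hom S A B" and q: "q \<in> Q" and B: "satisfies B q"
  shows "closed_under A (ker_rel A h) q"
  unfolding closed_under_def
proof (intro allI impI)
  fix v assume v: "range v \<subseteq> univ A"
    and prem: "\<forall>(s, t) \<in> fst q. (eval A v s, eval A v t) \<in> ker_rel A h"
  have e: "h (eval A v t) = eval B (h \<circ> v) t" if "t \<in> trms S UNIV" for t
    using hom_eval[OF that A v h, of "h \<circ> v"] by auto
  have "range (h \<circ> v) \<subseteq> univ B" using v hom_in_univ[OF h] by auto
  moreover have "\<forall>(s, t) \<in> fst q. eval B (h \<circ> v) s = eval B (h \<circ> v) t"
    using prem e quasiequation_terms(1)[OF q] by (fastforce simp: ker_rel_iff)
  ultimately have "eval B (h \<circ> v) (fst (snd q)) = eval B (h \<circ> v) (snd (snd q))"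
    using B unfolding satisfies_def by blast
  then show "(eval A v (fst (snd q)), eval A v (snd (snd q))) \<in> ker_rel A h"
    using e quasiequation_terms(2,3)[OF q] eval_in_univ[OF _ A v] by (simp add: ker_rel_iff)
qed

lemma satisfies_surj_image:
  assumes A: "is_algebra S A" and h: "h \<in> hom S A B" and surj: "h ` univ A = univ B"
    and q: "q \<in> Q" and cl: "closed_under A (ker_rel A h) q"
  shows "satisfies B q"
  unfolding satisfies_def
proof (intro allI impI)
  fix w assume w: "range w \<subseteq> univ B" and prem: "\<forall>(s, t) \<in> fst q. eval B w s = eval B w t"
  \<comment> \<open>Surjectivity lifts the valuation \<open>w\<close> in \<open>B\<close> to a
    valuation in \<open>A\<close>, where \<open>closed_under\<close> applies.\<close>
  define v where "v x = inv_into (univ A) h (w x)" for x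
  have v: "range v \<subseteq> univ A" and hv: "h (v x) = w x" for x
    using w surj by (auto simp: v_def inv_into_into f_inv_into_f image_subset_iff)
  have e: "h (eval A v t) = eval B w t" if "t \<in> trms S UNIV" for t
    using hom_eval[OF that A v h] hv by auto
  have "\<forall>(s, t) \<in> fst q. (eval A v s, eval A v t) \<in> ker_rel A h"
    using prem e quasiequation_terms(1)[OF q] eval_in_univ[OF _ A v] by (fastforce simp: ker_rel_iff)
  then have "(eval A v (fst (snd q)), eval A v (snd (snd q))) \<in> ker_rel A h"
    using cl v unfolding closed_under_def by blast
  then show "eval B w (fst (snd q)) = eval B w (snd (snd q))"
    using e quasiequation_terms(2,3)[OF q] by (simp add: ker_rel_iff)
qed

text \<open>The two preceding lemmas are applied to the quotient map, whose kernel is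
  \<open>\<theta>\<close>. From here on, membership of the quotient in the quasivariety is handled
  by closure conditions.\<close>

lemma relative_congruence_iff:
  assumes A: "is_algebra S A"
  shows "relative_congruence S Q A \<theta> \<longleftrightarrow> congruence S A \<theta> \<and> (\<forall>q \<in> Q. closed_under A \<theta> q)"
proof (cases "congruence S A \<theta>")
  case True
  note * = quotient_hom[OF A True] quotient_surj[OF A True] ker_rel_quotient[OF A True]
    is_algebra_quotient[OF A True]
  show ?thesis
    using closed_under_ker_rel[OF A *(1)] satisfies_surj_image[OF A *(1,2)] True *(4)
    by (auto simp: relative_congruence_def in_quasivariety_def *(3))
qed (simp add: relative_congruence_def)

lemma relative_congruence_ker_rel:
  assumes "is_algebra S A" "h \<in> hom S A B" "in_quasivariety S Q B"
  shows "relative_congruence S Q A (ker_rel A h)"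
  using assms congruence_ker_rel[OF assms(1,2)] closed_under_ker_rel[OF assms(1,2)]
  by (simp add: relative_congruence_iff in_quasivariety_def)

text \<open>The relation is the kernel of \<open>h\<close> followed by the quotient map of
  \<open>\<theta>\<close>, and that map ends in the quasivariety.\<close>

lemma relative_congruence_vimage:
  assumes A: "is_algebra S A" and h: "h \<in> hom S A B" and B: "is_algebra S B"
    and \<theta>: "relative_congruence S Q B \<theta>"
  shows "relative_congruence S Q A {(a, b). a \<in> univ A \<and> b \<in> univ A \<and> (h a, h b) \<in> \<theta>}"
proof -
  have c: "congruence S B \<theta>" using \<theta> by (simp add: relative_congruence_def)
  have "relative_congruence S Q A (ker_rel A ((\<lambda>b. \<theta> `` {b}) \<circ> h))"
    using \<theta> by (intro relative_congruence_ker_rel[OF A hom_comp[OF h quotient_hom[OF B c]]])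
      (simp add: relative_congruence_def)
  moreover have "ker_rel A ((\<lambda>b. \<theta> `` {b}) \<circ> h)
      = {(a, b). a \<in> univ A \<and> b \<in> univ A \<and> (h a, h b) \<in> \<theta>}"
    using eq_equiv_class_iff[of "univ B" \<theta>] c hom_in_univ[OF h]
    by (auto simp: ker_rel_def congruence_def)
  ultimately show ?thesis by simp
qed

text \<open>The quotient is trivial, and trivial algebras satisfy all quasiequations. Hence some
  relative congruence lies above any given relation on the universe, and the intersections that
  define free algebras and generated relative congruences are over nonempty families.\<close>

lemma relative_congruence_total:
  assumes A: "is_algebra S A"
  shows "relative_congruence S Q A (univ A \<times> univ A)"
  unfolding relative_congruence_iff[OF A]
proof (intro conjI ballI)
  have "ker_rel A (\<lambda>_. ()) = univ A \<times> univ A" by (auto simp: ker_rel_def)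
  moreover have "(\<lambda>_. ()) \<in> hom S A \<lparr>univ = UNIV, oper = \<lambda>_ _. ()\<rparr>" by (auto simp: hom_def)
  ultimately show "congruence S A (univ A \<times> univ A)" using congruence_ker_rel[OF A] by metis
  fix q assume "q \<in> Q"
  then show "closed_under A (univ A \<times> univ A) q"
    using quasiequation_terms(2,3)[of q] eval_in_univ[OF _ A, of _ UNIV]
    unfolding closed_under_def by blast
qed

lemma relative_congruence_Id:
  assumes "in_quasivariety S Q A"
  shows "relative_congruence S Q A (Id_on (univ A))"
proof -
  have "id \<in> hom S A A" by (auto simp: hom_def)
  moreover have "ker_rel A id = Id_on (univ A)" by (auto simp: ker_rel_def)
  ultimately show ?thesis
    using relative_congruence_ker_rel[of A id A] assms by (auto simp: in_quasivariety_def)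
qed

lemma relative_congruence_Inter:
  assumes A: "is_algebra S A" and F: "F \<noteq> {}" "\<And>\<theta>. \<theta> \<in> F \<Longrightarrow> relative_congruence S Q A \<theta>"
  shows "relative_congruence S Q A (\<Inter> F)"
proof -
  have c: "congruence S A \<theta>" and cl: "q \<in> Q \<Longrightarrow> closed_under A \<theta> q" if "\<theta> \<in> F" for \<theta> q
    using F(2)[OF that] A by (auto simp: relative_congruence_iff)
  have "equiv (univ A) (\<Inter> F)"
  proof (rule equivI)
    show "\<Inter> F \<subseteq> univ A \<times> univ A" using c congruence_subset F(1) by blast
    show "refl_on (univ A) (\<Inter> F)" using c congruence_refl by (fastforce simp: refl_on_def)
    show "sym (\<Inter> F)" using c by (auto simp: sym_def congruence_def equiv_def)
    show "trans (\<Inter> F)" using c unfolding trans_def congruence_def equiv_def by blast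
  qed
  moreover have "(oper A f as, oper A f bs) \<in> \<Inter> F"
    if "S f = Some (length as)" "list_all2 (\<lambda>a b. (a, b) \<in> \<Inter> F) as bs" for f as bs
  proof
    fix \<theta> assume \<theta>: "\<theta> \<in> F"
    then have "list_all2 (\<lambda>a b. (a, b) \<in> \<theta>) as bs"
      using that(2) by (auto elim!: list_all2_mono)
    then show "(oper A f as, oper A f bs) \<in> \<theta>"
      using c[OF \<theta>] that(1) by (simp add: congruence_def)
  qed
  moreover have "closed_under A (\<Inter> F) q" if "q \<in> Q" for q
    unfolding closed_under_def
  proof (intro allI impI InterI)
    fix v \<theta>
    assume v: "range v \<subseteq> univ A" and \<theta>: "\<theta> \<in> F"
      and "\<forall>(s, t) \<in> fst q. (eval A v s, eval A v t) \<in> \<Inter> F"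
    then have "\<forall>(s, t) \<in> fst q. (eval A v s, eval A v t) \<in> \<theta>" by auto
    then show "(eval A v (fst (snd q)), eval A v (snd (snd q))) \<in> \<theta>"
      using cl[OF \<theta> that] v unfolding closed_under_def by blast
  qed
  ultimately show ?thesis using A by (simp add: relative_congruence_iff congruence_def)
qed

end

section \<open>Directed unions and finitary generation of relative congruences\<close>

lemma finite_subset_Union_directed:
  assumes "finite E" "E \<subseteq> \<Union> F" "F \<noteq> {}"
    and "\<And>\<theta> \<psi>. \<theta> \<in> F \<Longrightarrow> \<psi> \<in> F \<Longrightarrow> \<exists>\<chi> \<in> F. \<theta> \<union> \<psi> \<subseteq> \<chi>"
  shows "\<exists>\<theta> \<in> F. E \<subseteq> \<theta>"
  using assms(1,2)
proof (induction E)
  case empty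
  then show ?case using assms(3) by auto
next
  case (insert x E)
  then obtain \<theta> \<psi> where "\<theta> \<in> F" "E \<subseteq> \<theta>" "\<psi> \<in> F" "x \<in> \<psi>" by auto
  then show ?case using assms(4)[of \<theta> \<psi>] by blast
qed

context quasivariety
begin

text \<open>Transitivity, compatibility with an operation and closure under a quasiequation each
  have finitely many premises, because arities and premise sets are finite. In a directed family
  these premises already hold in one member, which then contains the conclusion.\<close>

lemma relative_congruence_Union:
  assumes A: "is_algebra S A" and F: "F \<noteq> {}" "\<And>\<theta>. \<theta> \<in> F \<Longrightarrow> relative_congruence S Q A \<theta>"
    and dir: "\<And>\<theta> \<psi>. \<theta> \<in> F \<Longrightarrow> \<psi> \<in> F \<Longrightarrow> \<exists>\<chi> \<in> F. \<theta> \<union> \<psi> \<subseteq> \<chi>"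
  shows "relative_congruence S Q A (\<Union> F)"
proof -
  have c: "congruence S A \<theta>" and cl: "q \<in> Q \<Longrightarrow> closed_under A \<theta> q" if "\<theta> \<in> F" for \<theta> q
    using F(2)[OF that] A by (auto simp: relative_congruence_iff)
  note fin = finite_subset_Union_directed[OF _ _ F(1) dir]
  have "equiv (univ A) (\<Union> F)"
  proof (rule equivI)
    show "\<Union> F \<subseteq> univ A \<times> univ A" using c congruence_subset by blast
    show "refl_on (univ A) (\<Union> F)" using c congruence_refl F(1) by (fastforce simp: refl_on_def)
    show "sym (\<Union> F)" using c unfolding sym_def congruence_def equiv_def by blast
    show "trans (\<Union> F)"
    proof (rule transI)
      fix x y z assume "(x, y) \<in> \<Union> F" "(y, z) \<in> \<Union> F"
      then obtain \<theta> where \<theta>: "\<theta> \<in> F" "{(x, y), (y, z)} \<subseteq> \<theta>"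
        using fin[of "{(x, y), (y, z)}"] by auto
      then have "(x, z) \<in> \<theta>" using c[OF \<theta>(1)] by (auto simp: congruence_def equiv_def dest: transD)
      then show "(x, z) \<in> \<Union> F" using \<theta> by auto
    qed
  qed
  moreover have "(oper A f as, oper A f bs) \<in> \<Union> F"
    if f: "S f = Some (length as)" and l: "list_all2 (\<lambda>a b. (a, b) \<in> \<Union> F) as bs" for f as bs
  proof -
    have "set (zip as bs) \<subseteq> \<Union> F" using l by (auto simp: list_all2_iff)
    then obtain \<theta> where \<theta>: "\<theta> \<in> F" "set (zip as bs) \<subseteq> \<theta>" using fin[of "set (zip as bs)"] by auto
    then have "list_all2 (\<lambda>a b. (a, b) \<in> \<theta>) as bs" using l by (auto simp: list_all2_iff)
    then show ?thesis using c[OF \<theta>(1)] f \<theta>(1) by (auto simp: congruence_def)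
  qed
  moreover have "closed_under A (\<Union> F) q" if q: "q \<in> Q" for q
    unfolding closed_under_def
  proof (intro allI impI)
    fix v
    assume v: "range v \<subseteq> univ A" and "\<forall>(s, t) \<in> fst q. (eval A v s, eval A v t) \<in> \<Union> F"
    then have "(\<lambda>(s, t). (eval A v s, eval A v t)) ` fst q \<subseteq> \<Union> F" by fast
    then obtain \<theta> where \<theta>: "\<theta> \<in> F" "(\<lambda>(s, t). (eval A v s, eval A v t)) ` fst q \<subseteq> \<theta>"
      using fin[of "(\<lambda>(s, t). (eval A v s, eval A v t)) ` fst q"] quasiequation_terms(4)[OF q]
      by blast
    then have "\<forall>(s, t) \<in> fst q. (eval A v s, eval A v t) \<in> \<theta>" by fast
    then have "(eval A v (fst (snd q)), eval A v (snd (snd q))) \<in> \<theta>"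
      using cl[OF \<theta>(1) q] v unfolding closed_under_def by blast
    then show "(eval A v (fst (snd q)), eval A v (snd (snd q))) \<in> \<Union> F" using \<theta> by auto
  qed
  ultimately show ?thesis using A by (simp add: relative_congruence_iff congruence_def)
qed

text \<open>If \<open>E\<close> is not a relation on the universe, no relative congruence contains
  it and the intersection is \<open>UNIV\<close>. This is why results below require
  \<open>E \<subseteq> univ A \<times> univ A\<close>.\<close>

definition relcong_generated :: "('f, 'a) algebra \<Rightarrow> ('a \<times> 'a) set \<Rightarrow> ('a \<times> 'a) set" where
  "relcong_generated A E = \<Inter> {\<theta>. relative_congruence S Q A \<theta> \<and> E \<subseteq> \<theta>}"

lemma relcong_generated_least:
  "relative_congruence S Q A \<theta> \<Longrightarrow> E \<subseteq> \<theta> \<Longrightarrow> relcong_generated A E \<subseteq> \<theta>"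
  by (auto simp: relcong_generated_def)

lemma subset_relcong_generated: "E \<subseteq> relcong_generated A E"
  by (auto simp: relcong_generated_def)

lemma relcong_generated_mono: "E \<subseteq> E' \<Longrightarrow> relcong_generated A E \<subseteq> relcong_generated A E'"
  by (auto simp: relcong_generated_def)

lemma relative_congruence_generated:
  assumes A: "is_algebra S A" and E: "E \<subseteq> univ A \<times> univ A"
  shows "relative_congruence S Q A (relcong_generated A E)"
  unfolding relcong_generated_def
  using relative_congruence_total[OF A] E by (intro relative_congruence_Inter[OF A]) auto

text \<open>The relative congruences generated by finite subsets of \<open>E\<close> form a directed
  family, so their union is a relative congruence; as it contains \<open>E\<close>, it contains
  everything that \<open>E\<close> generates.\<close>

lemma relcong_generated_finitary:
  assumes A: "is_algebra S A" and E: "E \<subseteq> univ A \<times> univ A" and p: "p \<in> relcong_generated A E"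
  obtains E0 where "finite E0" "E0 \<subseteq> E" "p \<in> relcong_generated A E0"
proof -
  define F where "F = relcong_generated A ` {E0. finite E0 \<and> E0 \<subseteq> E}"
  have "relative_congruence S Q A (\<Union> F)"
  proof (rule relative_congruence_Union[OF A])
    show "F \<noteq> {}" by (auto simp: F_def)
    show "relative_congruence S Q A \<theta>" if "\<theta> \<in> F" for \<theta>
      using that relative_congruence_generated[OF A] E by (auto simp: F_def)
    show "\<exists>\<chi> \<in> F. \<theta> \<union> \<psi> \<subseteq> \<chi>" if \<theta>: "\<theta> \<in> F" and \<psi>: "\<psi> \<in> F" for \<theta> \<psi>
    proof -
      obtain E1 E2 where "finite E1" "E1 \<subseteq> E" "\<theta> = relcong_generated A E1"
        "finite E2" "E2 \<subseteq> E" "\<psi> = relcong_generated A E2"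
        using \<theta> \<psi> by (auto simp: F_def)
      then have "\<theta> \<union> \<psi> \<subseteq> relcong_generated A (E1 \<union> E2)" "relcong_generated A (E1 \<union> E2) \<in> F"
        using relcong_generated_mono[of _ "E1 \<union> E2" A] by (simp_all add: F_def)
      then show ?thesis by blast
    qed
  qed
  moreover have "E \<subseteq> \<Union> F"
  proof
    fix x assume "x \<in> E"
    then show "x \<in> \<Union> F"
      using subset_relcong_generated[of "{x}" A] by (auto simp: F_def intro!: exI[of _ "{x}"])
  qed
  ultimately have "p \<in> \<Union> F" using relcong_generated_least p by blast
  then show thesis using that by (auto simp: F_def)
qed

section \<open>Quotients within the quasivariety and relative simple images\<close>

lemma quotient_in_quasivariety:
  fixes A :: "('f, 'b) algebra" and e :: "'b \<Rightarrow> 'a"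
  assumes A: "is_algebra S A" and \<theta>: "relative_congruence S Q A \<theta>" and e: "inj_on e (univ A)"
  obtains B :: "('f, 'a) algebra" and h where "h \<in> hom S A B" "h ` univ A = univ B"
    "ker_rel A h = \<theta>" "in_quasivariety S Q B"
proof -
  have c: "congruence S A \<theta>" and cl: "\<And>q. q \<in> Q \<Longrightarrow> closed_under A \<theta> q"
    using \<theta> A by (auto simp: relative_congruence_iff)
  obtain B :: "('f, 'a) algebra" and h where *: "h \<in> hom S A B" "h ` univ A = univ B"
    "ker_rel A h = \<theta>" "is_algebra S B"
    using quotient_in_carrier_type[OF A c e] .
  then have "in_quasivariety S Q B"
    using satisfies_surj_image[OF A *(1,2)] cl by (simp add: in_quasivariety_def)
  then show thesis using that * by blast
qed

text \<open>This is the correspondence between relative congruences of the image and those of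
  \<open>A\<close> above the kernel: the pullback of a relative congruence of \<open>B\<close> is
  either the kernel or total.\<close>

lemma relative_simple_image:
  assumes A: "is_algebra S A" and h: "h \<in> hom S A B" and surj: "h ` univ A = univ B"
    and B: "in_quasivariety S Q B"
    and proper: "ker_rel A h \<noteq> univ A \<times> univ A"
    and max: "\<And>\<theta>. relative_congruence S Q A \<theta> \<Longrightarrow> ker_rel A h \<subseteq> \<theta> \<Longrightarrow>
        \<theta> = ker_rel A h \<or> \<theta> = univ A \<times> univ A"
  shows "relative_simple S Q B"
proof -
  have algB: "is_algebra S B" using B by (simp add: in_quasivariety_def)
  have "\<not> trivial_algebra B"
  proof
    assume "trivial_algebra B"
    then obtain b where "univ B = {b}" by (auto simp: trivial_algebra_def)
    then have "ker_rel A h = univ A \<times> univ A" using hom_in_univ[OF h] by (auto simp: ker_rel_def)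
    then show False using proper by simp
  qed
  moreover have "\<psi> = Id_on (univ B) \<or> \<psi> = univ B \<times> univ B" if \<psi>: "relative_congruence S Q B \<psi>" for \<psi>
  proof -
    define \<theta> where "\<theta> = {(a, b). a \<in> univ A \<and> b \<in> univ A \<and> (h a, h b) \<in> \<psi>}"
    have c: "congruence S B \<psi>" using \<psi> by (simp add: relative_congruence_def)
    have "relative_congruence S Q A \<theta>"
      unfolding \<theta>_def using relative_congruence_vimage[OF A h algB \<psi>] .
    moreover have "ker_rel A h \<subseteq> \<theta>"
      using congruence_refl[OF c] hom_in_univ[OF h] by (auto simp: \<theta>_def ker_rel_def)
    \<comment> \<open>Surjectivity recovers \<open>\<psi>\<close> from its pullback, so the
      alternative for \<open>\<theta>\<close> carries over to \<open>\<psi>\<close>.\<close>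
    moreover have \<psi>_eq: "\<psi> = {(h a, h b) | a b. (a, b) \<in> \<theta>}"
    proof -
      have "\<exists>a b. x = h a \<and> y = h b \<and> a \<in> univ A \<and> b \<in> univ A" if "(x, y) \<in> \<psi>" for x y
        using that congruence_subset[OF c] unfolding surj[symmetric] by blast
      moreover have "(h a, h b) \<in> \<psi>" if "(a, b) \<in> \<theta>" for a b using that by (simp add: \<theta>_def)
      ultimately show ?thesis by (fastforce simp: \<theta>_def)
    qed
    ultimately consider "\<theta> = ker_rel A h" | "\<theta> = univ A \<times> univ A" using max by blast
    then show ?thesis
    proof cases
      case 1
      then have "\<psi> = Id_on (univ B)"
        unfolding \<psi>_eq surj[symmetric] by (auto simp: ker_rel_def Id_on_def)
      then show ?thesis ..
    next
      case 2
      then have "\<psi> = univ B \<times> univ B" unfolding \<psi>_eq surj[symmetric] by auto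
      then show ?thesis ..
    qed
  qed
  ultimately show ?thesis
    using relative_congruence_Id[OF B] relative_congruence_total[OF algB]
    by (auto simp: relative_simple_def)
qed

section \<open>Free algebras and the Kollar property\<close>

lemma
  assumes "trms S X \<noteq> {}"
  defines "\<theta> \<equiv> \<Inter> {\<theta>. relative_congruence S Q (term_algebra S X) \<theta>}"
  shows relative_congruence_free: "relative_congruence S Q (term_algebra S X) \<theta>"
    and in_quasivariety_free: "in_quasivariety S Q (free_algebra S Q X)"
proof -
  note A = is_algebra_term_algebra[OF assms(1)]
  show "relative_congruence S Q (term_algebra S X) \<theta>"
    unfolding \<theta>_def using relative_congruence_total[OF A]
    by (intro relative_congruence_Inter[OF A]) auto
  then show "in_quasivariety S Q (free_algebra S Q X)"
    by (simp add: relative_congruence_def free_algebra_def \<theta>_def)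
qed

text \<open>The kernel of evaluation at \<open>v\<close> is among the relative congruences whose
  intersection defines the free algebra, so evaluation factors through it.\<close>

lemma free_algebra_hom:
  assumes X: "trms S X \<noteq> {}" and B: "in_quasivariety S Q B" and v: "v ` X \<subseteq> univ B"
  obtains k where "k \<in> hom S (free_algebra S Q X) B"
proof -
  let ?T = "term_algebra S X"
  let ?\<theta> = "\<Inter> {\<theta>. relative_congruence S Q ?T \<theta>}"
  note T = is_algebra_term_algebra[OF X]
  have c: "congruence S ?T ?\<theta>"
    using relative_congruence_free[OF X] by (simp add: relative_congruence_def)
  have ev: "eval B v \<in> hom S ?T B" using eval_hom v B by (auto simp: in_quasivariety_def)
  have "ker_rel ?T (\<lambda>a. ?\<theta> `` {a}) \<subseteq> ker_rel ?T (eval B v)"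
    unfolding ker_rel_quotient[OF T c] using relative_congruence_ker_rel[OF T ev B] by blast
  then show thesis
    using hom_factor[OF is_algebra_quotient[OF T c] quotient_hom[OF T c] quotient_surj[OF T c] ev _ T]
      that unfolding free_algebra_def by blast
qed

lemma least_free_algebra_hom:
  obtains k where "k \<in> hom S (least_free_algebra S Q) (free_omega S Q)"
proof -
  have "Var 0 \<in> trms S (UNIV :: nat set)" by (auto intro: trms.intros)
  then have F: "in_quasivariety S Q (free_omega S Q)" by (intro in_quasivariety_free) auto
  then obtain u where u: "u \<in> univ (free_omega S Q)"
    by (auto simp: in_quasivariety_def is_algebra_def)
  \<comment> \<open>With a constant in the type, ground terms are evaluated in the target; otherwise
    the single generator is sent to an arbitrary element \<open>u\<close>.\<close>
  show thesis
  proof (cases "\<exists>c. S c = Some 0")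
    case True
    then obtain c where "S c = Some 0" ..
    then have "App c [] \<in> trms S ({} :: nat set)" by (intro trms_App) auto
    then show thesis
      using free_algebra_hom[of "{}" "free_omega S Q" "\<lambda>_. u"] F True that
      by (auto simp: least_free_algebra_def)
  next
    case False
    have "Var 0 \<in> trms S {0 :: nat}" by (auto intro: trms.intros)
    then show thesis
      using free_algebra_hom[of "{0}" "free_omega S Q" "\<lambda>_. u"] F False u that
      by (auto simp: least_free_algebra_def)
  qed
qed

text \<open>In the quotient by all these equations the class of \<open>Var 0\<close> forms a
  one-element subalgebra, so the Kollar property makes the quotient trivial and identifies
  \<open>Var 1\<close> with \<open>Var 2\<close>. Finitary generation then leaves finitely many
  equations, however many operation symbols there are. The variables 1 and 2 are distinct from 0 so
  that they can be evaluated freely later.\<close>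

lemma kollar_finite_equations:
  assumes large: "large_carrier_type TYPE('a) S" and kollar: "kollar_quasivariety TYPE('a) S Q"
  obtains E where "finite E" "E \<subseteq> {(Var 0, App f (replicate n (Var 0))) | f n. S f = Some n}"
    "(Var 1, Var 2) \<in> relcong_generated (term_algebra S (UNIV :: nat set)) E"
proof -
  let ?T = "term_algebra S (UNIV :: nat set)"
  let ?E = "{(Var 0, App f (replicate n (Var 0))) | f n. S f = Some n} :: 'f equation set"
  have T: "is_algebra S ?T" by (rule is_algebra_term_algebra) (auto intro: trms.intros)
  have E: "?E \<subseteq> univ ?T \<times> univ ?T" by (auto intro!: trms.intros)
  obtain e :: "('f, nat) trm \<Rightarrow> 'a" where e: "inj_on e (univ ?T)"
    using large by (auto simp: large_carrier_type_def)
  obtain A :: "('f, 'a) algebra" and h where h: "h \<in> hom S ?T A"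
    and ker: "ker_rel ?T h = relcong_generated ?T ?E" and A: "in_quasivariety S Q A"
    using quotient_in_quasivariety[OF T relative_congruence_generated[OF T E] e] .
  have V: "Var x \<in> trms S (UNIV :: nat set)" for x by (auto intro: trms.intros)
  have triv: "trivial_algebra A"
  proof (rule ccontr)
    assume "\<not> trivial_algebra A"
    then have no: "\<not> (\<exists>B. subalgebra S B A \<and> trivial_algebra B)"
      using kollar A by (auto simp: kollar_quasivariety_def kollar_algebra_def)
    define B where "B = A\<lparr>univ := {h (Var 0)}\<rparr>"
    have "oper A f as = h (Var 0)" if f: "S f = Some (length as)" and as: "set as \<subseteq> {h (Var 0)}"
      for f as
    proof -
      \<comment> \<open>All arguments equal \<open>h (Var 0)\<close>, so \<open>oper A f as\<close>
        is the image of the right side of an equation in \<open>?E\<close>; constants are the case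
        of the empty list.\<close>
      have "as = map h (replicate (length as) (Var 0))"
        using as by (intro nth_equalityI) (auto simp: subset_iff)
      then have "oper A f as = h (App f (replicate (length as) (Var 0)))"
        using hom_oper[OF h, of f "replicate (length as) (Var 0)"] f V by (auto simp: subset_iff)
      also have "(Var 0, App f (replicate (length as) (Var 0))) \<in> ker_rel ?T h"
        unfolding ker using subset_relcong_generated[of ?E ?T] f by blast
      then have "h (App f (replicate (length as) (Var 0))) = h (Var 0)" by (simp add: ker_rel_iff)
      finally show ?thesis .
    qed
    then have "subalgebra S B A"
      using hom_in_univ[OF h] V by (auto simp: subalgebra_def is_algebra_def B_def)
    moreover have "trivial_algebra B" by (simp add: trivial_algebra_def B_def)
    ultimately show False using no by blast
  qed
  then have "h (Var 1) = h (Var 2)"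
    using hom_in_univ[OF h] V by (fastforce simp: trivial_algebra_def)
  then have "(Var 1, Var 2) \<in> relcong_generated ?T ?E"
    unfolding ker[symmetric] using V by (simp add: ker_rel_iff)
  then show thesis by (rule relcong_generated_finitary[OF T E]) (rule that)
qed

text \<open>The finite set of equations from \<open>kollar_finite_equations\<close>, evaluated at a
  single element, becomes a finite set of pairs. If the union were total, one member of the chain
  would contain them all, and they force that member to be total.\<close>

lemma Union_chain_proper_relative_congruences:
  fixes A :: "('f, 'b) algebra"
  assumes large: "large_carrier_type TYPE('a) S" and kollar: "kollar_quasivariety TYPE('a) S Q"
    and A: "is_algebra S A" and C: "C \<noteq> {}" "\<And>\<theta> \<psi>. \<theta> \<in> C \<Longrightarrow> \<psi> \<in> C \<Longrightarrow> \<theta> \<subseteq> \<psi> \<or> \<psi> \<subseteq> \<theta>"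
    and rel: "\<And>\<theta>. \<theta> \<in> C \<Longrightarrow> relative_congruence S Q A \<theta>"
    and proper: "\<And>\<theta>. \<theta> \<in> C \<Longrightarrow> \<theta> \<noteq> univ A \<times> univ A"
  shows "\<Union> C \<noteq> univ A \<times> univ A"
proof
  assume total: "\<Union> C = univ A \<times> univ A"
  let ?T = "term_algebra S (UNIV :: nat set)"
  have T: "is_algebra S ?T" by (rule is_algebra_term_algebra) (auto intro: trms.intros)
  obtain E where fin: "finite E"
    and E: "E \<subseteq> {(Var 0, App f (replicate n (Var 0))) | f n. S f = Some n}"
    and E12: "(Var 1, Var 2) \<in> relcong_generated ?T E"
    using kollar_finite_equations[OF large kollar] .
  have ET: "E \<subseteq> univ ?T \<times> univ ?T" using E by (force intro!: trms.intros)
  obtain d where d: "d \<in> univ A" using A by (auto simp: is_algebra_def)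
  let ?D = "(\<lambda>(s, t). (eval A (\<lambda>_. d) s, eval A (\<lambda>_. d) t)) ` E"
  have "eval A (\<lambda>_. d) t \<in> univ A" if "t \<in> trms S (UNIV :: nat set)" for t
    using eval_in_univ[OF that A] d by auto
  then have DC: "?D \<subseteq> \<Union> C" using ET by (auto simp: total)
  have dir: "\<exists>\<chi> \<in> C. \<theta> \<union> \<psi> \<subseteq> \<chi>" if "\<theta> \<in> C" "\<psi> \<in> C" for \<theta> \<psi>
    using C(2)[OF that] that by (elim disjE) auto
  obtain \<theta> where \<theta>: "\<theta> \<in> C" "?D \<subseteq> \<theta>"
    using finite_subset_Union_directed[OF finite_imageI[OF fin] DC C(1) dir] by blast
  have "(a, b) \<in> \<theta>" if a: "a \<in> univ A" and b: "b \<in> univ A" for a b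
  proof -
    \<comment> \<open>\<open>w\<close> still sends 0, the only variable in \<open>E\<close>, to
      \<open>d\<close>. So the pullback of \<open>\<theta>\<close> along \<open>eval A w\<close>
      contains \<open>E\<close>, hence also the pair of \<open>Var 1\<close> and
      \<open>Var 2\<close>, whose values are \<open>a\<close> and \<open>b\<close>.\<close>
    define w where "w = (\<lambda>_::nat. d)(1 := a, 2 := b)"
    have "range w \<subseteq> univ A" using a b d by (auto simp: w_def)
    then have w: "eval A w \<in> hom S ?T A" by (rule eval_hom[OF A])
    have "eval A w s = eval A (\<lambda>_. d) s \<and> eval A w t = eval A (\<lambda>_. d) t" if "(s, t) \<in> E" for s t
      using E that by (auto simp: w_def)
    then have "E \<subseteq> {(s, t). s \<in> univ ?T \<and> t \<in> univ ?T \<and> (eval A w s, eval A w t) \<in> \<theta>}"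
      using ET \<theta>(2) by fastforce
    then have "(eval A w (Var 1), eval A w (Var 2)) \<in> \<theta>"
      using relcong_generated_least[OF relative_congruence_vimage[OF T w A rel[OF \<theta>(1)]]] E12 by blast
    then show ?thesis by (simp add: w_def)
  qed
  then have "\<theta> = univ A \<times> univ A" using \<theta>(1) total by auto
  then show False using proper \<theta>(1) by blast
qed

lemma maximal_relative_congruence:
  assumes large: "large_carrier_type TYPE('a) S" and kollar: "kollar_quasivariety TYPE('a) S Q"
    and A: "is_algebra S A" and \<theta>: "relative_congruence S Q A \<theta>" "\<theta> \<noteq> univ A \<times> univ A"
  obtains M where "relative_congruence S Q A M" "\<theta> \<subseteq> M" "M \<noteq> univ A \<times> univ A"
    "\<And>\<psi>. relative_congruence S Q A \<psi> \<Longrightarrow> M \<subseteq> \<psi> \<Longrightarrow> \<psi> = M \<or> \<psi> = univ A \<times> univ A"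
proof -
  define P where "P = {\<psi>. relative_congruence S Q A \<psi> \<and> \<theta> \<subseteq> \<psi> \<and> \<psi> \<noteq> univ A \<times> univ A}"
  have "\<exists>M \<in> P. \<forall>\<psi> \<in> P. M \<subseteq> \<psi> \<longrightarrow> \<psi> = M"
  \<comment> \<open>This form of Zorn's lemma asks for unions of nonempty chains only; the empty
    union is not reflexive.\<close>
  proof (rule subset_Zorn_nonempty)
    show "P \<noteq> {}" using \<theta> by (auto simp: P_def)
    fix C assume C: "C \<noteq> {}" "subset.chain P C"
    then have CP: "C \<subseteq> P" and lin: "\<And>\<theta> \<psi>. \<theta> \<in> C \<Longrightarrow> \<psi> \<in> C \<Longrightarrow> \<theta> \<subseteq> \<psi> \<or> \<psi> \<subseteq> \<theta>"
      by (auto simp: subset_chain_def)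
    have rel: "relative_congruence S Q A \<psi>" and pr: "\<psi> \<noteq> univ A \<times> univ A" if "\<psi> \<in> C" for \<psi>
      using that CP by (auto simp: P_def)
    have dir: "\<exists>\<chi> \<in> C. \<theta> \<union> \<psi> \<subseteq> \<chi>" if "\<theta> \<in> C" "\<psi> \<in> C" for \<theta> \<psi>
      using lin[OF that] that by (elim disjE) auto
    have "relative_congruence S Q A (\<Union> C)"
      by (rule relative_congruence_Union[OF A C(1) rel dir])
    moreover have "\<theta> \<subseteq> \<Union> C" using C(1) CP by (auto simp: P_def)
    ultimately show "\<Union> C \<in> P"
      using Union_chain_proper_relative_congruences[OF large kollar A C(1) lin rel pr]
      by (simp add: P_def)
  qed
  then obtain M where M: "M \<in> P" "\<And>\<psi>. \<psi> \<in> P \<Longrightarrow> M \<subseteq> \<psi> \<Longrightarrow> \<psi> = M" by blast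
  show thesis
  proof (rule that[of M])
    show "relative_congruence S Q A M" "\<theta> \<subseteq> M" "M \<noteq> univ A \<times> univ A"
      using M(1) by (auto simp: P_def)
    show "\<psi> = M \<or> \<psi> = univ A \<times> univ A" if "relative_congruence S Q A \<psi>" "M \<subseteq> \<psi>" for \<psi>
      using M(2)[of \<psi>] M(1) that by (auto simp: P_def)
  qed
qed

end

section \<open>From a failing passive quasiequation to a unifier of its premises\<close>

lemma finitely_generated_term_image:
  assumes "finite X" "h \<in> hom S (term_algebra S X) B" "h ` trms S X = univ B" "is_algebra S B"
  shows "finitely_generated S B"
proof -
  let ?G = "(\<lambda>x. h (Var x)) ` X"
  have G: "?G \<subseteq> univ B"
    unfolding assms(3)[symmetric] by (auto intro: trms.intros)
  have "h t \<in> generated S B ?G" if "t \<in> trms S X" for t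
    using that
  proof induction
    case (trms_Var x)
    then show ?case by (auto intro: gen_base)
  next
    case (trms_App f ts)
    then have "oper B f (map h ts) \<in> generated S B ?G" by (intro gen_oper) auto
    then show ?case using hom_oper[OF assms(2), of f ts] trms_App by (auto simp: subset_iff)
  qed
  then have "univ B \<subseteq> generated S B ?G" unfolding assms(3)[symmetric] by auto
  moreover have "x \<in> univ B" if "x \<in> generated S B ?G" for x
    using that by induction (use G oper_in_univ[OF assms(4)] in \<open>auto simp: subset_iff\<close>)
  ultimately show ?thesis
    unfolding finitely_generated_def using assms(1) G by (intro exI[of _ ?G]) auto
qed

theorem theorem4p29:
  fixes S :: "'f signature" and Q :: "'f quasiequation set"
  assumes "large_carrier_type TYPE('a) S"
    and "\<forall>q \<in> Q. is_quasiequation S q"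
    and "kollar_quasivariety TYPE('a) S Q"
    and "fg_relative_simple S Q (least_free_algebra S Q)"
    and "\<forall>A :: ('f, 'a) algebra. fg_relative_simple S Q A \<longrightarrow>
           isomorphic S A (least_free_algebra S Q)"
  shows "passive_structurally_complete TYPE('b) S Q"
proof -
  interpret quasivariety S Q by unfold_locales (rule assms(2))
  have "satisfies B q"
    if q: "is_quasiequation S q" and pas: "passive_quasiequation S Q q"
      and B: "in_quasivariety S Q B" for q and B :: "('f, 'b) algebra"
  proof (rule ccontr)
    assume "\<not> satisfies B q"
    then obtain v where v: "range v \<subseteq> univ B"
      and prem: "\<And>s t. (s, t) \<in> fst q \<Longrightarrow> eval B v s = eval B v t"
      and concl: "eval B v (fst (snd q)) \<noteq> eval B v (snd (snd q))"
      unfolding satisfies_def by blast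
    \<comment> \<open>Finiteness of \<open>X\<close> will make the simple quotient finitely
      generated. The element 0 keeps \<open>X\<close> nonempty and serves as the default variable in
      \<open>w\<close>.\<close>
    define X where "X = insert 0 (\<Union>(s, t) \<in> insert (snd q) (fst q). set2_trm s \<union> set2_trm t)"
    have fin: "finite X"
      using q finite_vars by (auto simp: X_def is_quasiequation_def)
    have terms: "s \<in> trms S X \<and> t \<in> trms S X" if "(s, t) \<in> insert (snd q) (fst q)" for s t
    proof -
      have "s \<in> trms S UNIV" "t \<in> trms S UNIV"
        using q that by (auto simp: is_quasiequation_def)
      moreover have "set2_trm s \<subseteq> X" "set2_trm t \<subseteq> X"
        using that unfolding X_def by fastforce+
      ultimately show ?thesis using trms_superset_vars by blast
    qed
    let ?T = "term_algebra S X"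
    have V: "Var x \<in> trms S X" if "x \<in> X" for x using that by (rule trms_Var)
    have "0 \<in> X" by (simp add: X_def)
    then have T: "is_algebra S ?T" using V by (intro is_algebra_term_algebra) auto
    have algB: "is_algebra S B" using B by (simp add: in_quasivariety_def)
    have ev: "eval B v \<in> hom S ?T B" using v by (intro eval_hom[OF algB]) auto
    \<comment> \<open>Through this kernel the argument passes from \<open>B\<close> to terms over
      \<open>X\<close>; the carrier type \<open>'b\<close> of \<open>B\<close> can thus be unrelated
      to \<open>'a\<close>.\<close>
    let ?\<theta> = "ker_rel ?T (eval B v)"
    have "(fst (snd q), snd (snd q)) \<in> univ ?T \<times> univ ?T - ?\<theta>"
      using terms[of "fst (snd q)" "snd (snd q)"] concl
      by (simp add: ker_rel_def mem_Times_iff case_prod_beta)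
    then have "?\<theta> \<noteq> univ ?T \<times> univ ?T" by blast
    then obtain M where M: "relative_congruence S Q ?T M" "?\<theta> \<subseteq> M" "M \<noteq> univ ?T \<times> univ ?T"
      and max: "\<And>\<psi>. relative_congruence S Q ?T \<psi> \<Longrightarrow> M \<subseteq> \<psi> \<Longrightarrow> \<psi> = M \<or> \<psi> = univ ?T \<times> univ ?T"
      using maximal_relative_congruence[OF assms(1,3) T relative_congruence_ker_rel[OF T ev B]] by metis
    obtain e :: "('f, nat) trm \<Rightarrow> 'a" where "inj_on e (trms S UNIV)"
      using assms(1) by (auto simp: large_carrier_type_def)
    then have e: "inj_on e (univ ?T)"
      by (rule inj_on_subset) (auto intro: trms_mono)
    obtain A :: "('f, 'a) algebra" and h where h: "h \<in> hom S ?T A" "h ` univ ?T = univ A"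
      and ker: "ker_rel ?T h = M" and A: "in_quasivariety S Q A"
      using quotient_in_quasivariety[OF T M(1) e] .
    have "relative_simple S Q A"
      using relative_simple_image[OF T h A] M(3) max by (simp add: ker)
    moreover have "finitely_generated S A"
      using finitely_generated_term_image[OF fin h(1)] h(2) A by (simp add: in_quasivariety_def)
    ultimately have "isomorphic S A (least_free_algebra S Q)"
      using assms(5) A by (simp add: fg_relative_simple_def)
    then obtain g where "g \<in> hom S A (least_free_algebra S Q)" by (auto simp: isomorphic_def)
    moreover obtain k where "k \<in> hom S (least_free_algebra S Q) (free_omega S Q)"
      using least_free_algebra_hom .
    ultimately have u: "k \<circ> (g \<circ> h) \<in> hom S ?T (free_omega S Q)" (is "?u \<in> _")
      by (intro hom_comp[OF hom_comp[OF h(1)]])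
    \<comment> \<open>A substitution acts on terms over all variables, while \<open>?u\<close> is
      only known to be a homomorphism on terms over \<open>X\<close>; variables outside
      \<open>X\<close> are treated like \<open>Var 0\<close>.\<close>
    define w where "w x = ?u (Var (if x \<in> X then x else 0))" for x
    have "range w \<subseteq> univ (free_omega S Q)"
      using hom_in_univ[OF u] V \<open>0 \<in> X\<close> by (auto simp: w_def simp del: comp_apply)
    moreover have "is_algebra S (free_omega S Q)"
      using in_quasivariety_free[of UNIV] V trms_mono \<open>0 \<in> X\<close>
      by (fastforce simp: in_quasivariety_def)
    ultimately have "eval (free_omega S Q) w \<in> substitutions S Q"
      unfolding substitutions_def by (intro eval_hom) auto
    moreover have "unifies (eval (free_omega S Q) w) (fst q)"
      unfolding unifies_def
    proof clarify
      fix s t assume st: "(s, t) \<in> fst q"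
      then have X: "s \<in> trms S X" "t \<in> trms S X" using terms by auto
      have "?u r = eval (free_omega S Q) w r" if "r \<in> trms S X" for r
        using hom_eval[OF that T _ u, of Var w] V
        by (auto simp: eval_term_algebra_Var w_def)
      \<comment> \<open>The premises hold in \<open>B\<close> under \<open>v\<close>, so they lie in
        \<open>?\<theta>\<close>, hence in \<open>M\<close>, the kernel of \<open>h\<close>; as
        \<open>?u\<close> factors through \<open>h\<close>, it identifies their two sides.\<close>
      moreover have "(s, t) \<in> ker_rel ?T h"
        unfolding ker using M(2) X prem[OF st] by (auto simp: ker_rel_iff)
      ultimately show "eval (free_omega S Q) w s = eval (free_omega S Q) w t"
        using X by (metis comp_apply ker_rel_iff)
    qed
    ultimately show False using pas by (auto simp: passive_quasiequation_def)
  qed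
  then show ?thesis
    by (auto simp: passive_structurally_complete_def valid_in_quasivariety_def)
qed

end
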